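(* Let $R$ be a reduced commutative ring with identity such that $\mathrm{sdim}_M(\Gamma(R))$ is finite. Then: (1) If $|\mathrm{Max}(R)|=2$, then $\mathrm{sdim}_M(\Gamma(R))=1$. (2) If $|\mathrm{Max}(R)|=n\geq 3$, then $\mathrm{sdim}_M(\Gamma(R))=2^n-2n$.
   Context: The co-maximal ideal graph $\Gamma(R)$ has as vertices the proper ideals of $R$ not contained in the Jacobson radical $J(R)$, two distinct vertices $I,J$ adjacent iff $I+J=R$. $\mathrm{Max}(R)$ is the set of maximal ideals; $R$ is reduced if it has no nonzero nilpotent elements. For a connected graph $G$, a vertex $w$ strongly resolves vertices $u,v$ if there is a shortest $u$–$w$ path containing $v$ or a shortest $v$–$w$ path containing $u$; a set $W$ of vertices is a strong resolving set if every pair of distinct vertices is strongly resolved by some vertex of $W$; $\mathrm{sdim}_M(G)$ is the minimum cardinality of a strong resolving set. *)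

theory Defs
  imports
    "HOL-Algebra.Ideal"
    "HOL-Library.Extended_Nat"
    "Graph_Theory.Pair_Digraph"
begin

section \<open>Strong metric dimension\<close>

text \<open>Following the Graph_Theory library, an undirected graph is modelled as a symmetric digraph.
  A path is given by its list of arcs, so its length is the number of edges, and it may be empty.\<close>

definition shortest_path ::
  "('a, 'b) pre_digraph \<Rightarrow> 'a \<Rightarrow> 'b awalk \<Rightarrow> 'a \<Rightarrow> bool" where
  "shortest_path G u p v \<longleftrightarrow>
     pre_digraph.apath G u p v \<and> (\<forall>q. pre_digraph.apath G u q v \<longrightarrow> length p \<le> length q)"

definition strongly_resolves :: "('a, 'b) pre_digraph \<Rightarrow> 'a \<Rightarrow> 'a \<Rightarrow> 'a \<Rightarrow> bool" where
  "strongly_resolves G w u v \<longleftrightarrow>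
     (\<exists>p. shortest_path G u p w \<and> v \<in> set (pre_digraph.awalk_verts G u p)) \<or>
     (\<exists>p. shortest_path G v p w \<and> u \<in> set (pre_digraph.awalk_verts G v p))"

definition strong_resolving_set :: "('a, 'b) pre_digraph \<Rightarrow> 'a set \<Rightarrow> bool" where
  "strong_resolving_set G W \<longleftrightarrow>
     W \<subseteq> verts G \<and>
     (\<forall>u \<in> verts G. \<forall>v \<in> verts G. u \<noteq> v \<longrightarrow> (\<exists>w \<in> W. strongly_resolves G w u v))"

definition ecard :: "'a set \<Rightarrow> enat" where
  "ecard A = (if finite A then enat (card A) else \<infinity>)"

text \<open>An infimum of a nonempty set of extended naturals is attained, so this is a minimum
  whenever a strong resolving set exists; in a connected graph the set of all vertices is one.\<close>

definition sdim :: "('a, 'b) pre_digraph \<Rightarrow> enat" where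
  "sdim G = (INF W \<in> {W. strong_resolving_set G W}. ecard W)"


section \<open>The co-maximal ideal graph\<close>

definition Max_ideals :: "('a, 'r) ring_scheme \<Rightarrow> 'a set set" where
  "Max_ideals R = {M. maximalideal M R}"

text \<open>Intersecting with the carrier only matters for the zero ring, which has no maximal ideals.\<close>

definition jacobson_radical :: "('a, 'r) ring_scheme \<Rightarrow> 'a set" where
  "jacobson_radical R = carrier R \<inter> \<Inter> (Max_ideals R)"

definition reduced_ring :: "('a, 'r) ring_scheme \<Rightarrow> bool" where
  "reduced_ring R \<longleftrightarrow>
     (\<forall>x \<in> carrier R. (\<exists>n::nat. x [^]\<^bsub>R\<^esub> n = \<zero>\<^bsub>R\<^esub>) \<longrightarrow> x = \<zero>\<^bsub>R\<^esub>)"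

definition comaximal_vertices :: "('a, 'r) ring_scheme \<Rightarrow> 'a set set" where
  "comaximal_vertices R =
     {I. ideal I R \<and> I \<noteq> carrier R \<and> \<not> I \<subseteq> jacobson_radical R}"

definition comaximal_ideal_graph :: "('a, 'r) ring_scheme \<Rightarrow> 'a set pair_pre_digraph" where
  "comaximal_ideal_graph R =
     \<lparr> pverts = comaximal_vertices R,
       parcs = {(I, J). I \<in> comaximal_vertices R \<and> J \<in> comaximal_vertices R \<and>
                        I \<noteq> J \<and> I <+>\<^bsub>R\<^esub> J = carrier R} \<rparr>"

lemma (in cring) comaximal_ideal_graph_bidirected:
  "pair_bidirected_digraph (comaximal_ideal_graph R)"
proof
  have comm: "I <+>\<^bsub>R\<^esub> J = J <+>\<^bsub>R\<^esub> I" if "ideal I R" "ideal J R" for I J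
    using that set_add_comm ideal.Icarr by (metis subsetI)
  show "symmetric (with_proj (comaximal_ideal_graph R))"
    using comm
    by (auto simp: symmetric_def sym_def comaximal_ideal_graph_def comaximal_vertices_def)
qed (auto simp: comaximal_ideal_graph_def)

end

theory Submission
  imports Defs "HOL-Algebra.Ring_Divisibility"
begin

text \<open>The ideals \<open>(x\<^sup>k)\<close> with \<open>k \<ge> 1\<close> lie in the same maximal ideals, so for \<open>x \<notin> J(R)\<close> not a unit
  they are twins in the graph, and a strong resolving set misses at most one of several twins. A
  finite strong resolving set thus forces \<open>(x\<^sup>j) = (x\<^sup>k)\<close> for some \<open>j < k\<close>, which in a reduced ring
  gives \<open>x \<in> (x\<^sup>2)\<close>. Hence every vertex is the intersection of the maximal ideals containing it,
  and the graph becomes the disjointness graph on the nonempty proper subsets of an \<open>n\<close>-element set.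
  There, for \<open>n \<ge> 3\<close>, two vertices are mutually maximally distant iff they are incomparable and
  intersect, so a set is strong resolving iff its complement is a laminar family. A laminar
  family of nonempty proper subsets has at most \<open>2 n - 2\<close> members, and this bound is attained.\<close>

section \<open>Strong resolution and maximally distant vertices\<close>

context wf_digraph
begin

text \<open>Cutting a cycle out of a walk with a repeated vertex shortens it strictly, so a path
  that is shortest among paths is shortest among walks. Later arguments can therefore join walks
  freely.\<close>

lemma shortest_path_le_awalk:
  assumes "shortest_path G u p v" and "awalk u q v"
  shows "length p \<le> length q"
  using assms(2)
proof (induction "length q" arbitrary: q rule: less_induct)
  case less
  show ?case
  proof (cases "distinct (awalk_verts u q)")
    case True
    with less.prems assms(1) show ?thesis
      by (auto simp: shortest_path_def apath_def)
  next
    case False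
    with less.prems obtain q1 r q2 w where q: "q = q1 @ r @ q2" "0 < length r"
        "awalk u q1 w" "awalk w q2 v"
      using awalk_not_distinct_decomp[of u q v] by blast
    then have "awalk u (q1 @ q2) v" by auto
    with less.hyps[of "q1 @ q2"] q show ?thesis by auto
  qed
qed

lemma shortest_awalk_imp_shortest_path:
  assumes "awalk u p v" and short: "\<And>q. awalk u q v \<Longrightarrow> length p \<le> length q"
  shows "shortest_path G u p v"
proof -
  have "distinct (awalk_verts u p)"
  proof (rule ccontr)
    assume "\<not> ?thesis"
    with assms(1) obtain q1 r q2 w where q: "p = q1 @ r @ q2" "0 < length r"
        "awalk u q1 w" "awalk w q2 v"
      using awalk_not_distinct_decomp[of u p v] by blast
    then have "awalk u (q1 @ q2) v" by auto
    from short[OF this] q show False by auto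
  qed
  with assms show ?thesis by (auto simp: shortest_path_def apath_def)
qed

lemma strongly_resolvesI:
  assumes "awalk u p v" "awalk v q w"
    and "\<And>r. awalk u r w \<Longrightarrow> length (p @ q) \<le> length r"
  shows "strongly_resolves G w u v" "strongly_resolves G w v u"
proof -
  have "awalk u (p @ q) w" using assms(1,2) by auto
  then have "shortest_path G u (p @ q) w"
    using assms(3) by (rule shortest_awalk_imp_shortest_path)
  moreover have "v \<in> set (awalk_verts u (p @ q))"
    using assms(1,2) hd_in_awalk_verts(1)[OF assms(2)]
    by (auto simp: set_awalk_verts_append[OF assms(1,2)])
  ultimately show "strongly_resolves G w u v" "strongly_resolves G w v u"
    unfolding strongly_resolves_def by blast+
qed

lemma strongly_resolves_endpoint:
  assumes "awalk u p v"
  shows "strongly_resolves G v u v" "strongly_resolves G v v u"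
proof -
  define q where "q = (ARG_MIN length q. awalk u q v)"
  have q: "awalk u q v" and "\<And>r. awalk u r v \<Longrightarrow> length q \<le> length r"
    using arg_min_nat_lemma[of "\<lambda>q. awalk u q v" p length] assms by (auto simp: q_def)
  moreover have "awalk v [] v" using assms by (auto simp: awalk_Nil_iff)
  ultimately show "strongly_resolves G v u v" "strongly_resolves G v v u"
    using strongly_resolvesI[of u q v "[]" v] by auto
qed

text \<open>In a connected graph this says that no neighbour of \<open>v\<close> is farther from
  \<open>u\<close> than \<open>v\<close> itself. One walk \<open>q\<close> compared with all walks
  to \<open>v\<close> expresses this without a distance function.\<close>

definition maximally_distant :: "'a \<Rightarrow> 'a \<Rightarrow> bool" where
  "maximally_distant u v \<longleftrightarrow>
     (\<forall>e \<in> arcs G. tail G e = v \<longrightarrow>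
       (\<exists>q. awalk u q (head G e) \<and> (\<forall>p. awalk u p v \<longrightarrow> length q \<le> length p)))"

text \<open>A shortest path that went on beyond \<open>v\<close> would continue to a neighbour
  farther from \<open>u\<close>.\<close>

lemma shortest_path_through_maximally_distant:
  assumes "shortest_path G u p w" "v \<in> set (awalk_verts u p)" "maximally_distant u v"
  shows "w = v"
proof (rule ccontr)
  assume "w \<noteq> v"
  from assms(1) have "awalk u p w" by (auto simp: shortest_path_def apath_def)
  with assms(2) obtain p1 p2 where p: "p = p1 @ p2" "awalk u p1 v" "awalk v p2 w"
    using awalk_decomp by blast
  with \<open>w \<noteq> v\<close> obtain e p3 where p2: "p2 = e # p3" "e \<in> arcs G" "tail G e = v"
      "awalk (head G e) p3 w"
    by (cases p2) (auto simp: awalk_simps)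
  with assms(3) p(2) obtain q where "awalk u q (head G e)" "length q \<le> length p1"
    unfolding maximally_distant_def by blast
  \<comment> \<open>Replacing \<open>p1\<close> and the arc \<open>e\<close> by \<open>q\<close>
    saves at least one arc.\<close>
  with p2(4) have "awalk u (q @ p3) w" "length (q @ p3) < length p"
    using p(1) p2(1) by auto
  with shortest_path_le_awalk[OF assms(1), of "q @ p3"] show False by simp
qed

lemma strongly_resolves_maximally_distant:
  assumes "strongly_resolves G w u v" "maximally_distant u v" "maximally_distant v u"
  shows "w = u \<or> w = v"
  using assms shortest_path_through_maximally_distant unfolding strongly_resolves_def by blast

text \<open>Only the endpoints can resolve a mutually maximally distant pair, so a strong resolving
  set is a vertex cover of the graph formed by these pairs.\<close>

lemma strong_resolving_set_maximally_distant:
  assumes "strong_resolving_set G W" "u \<in> verts G" "v \<in> verts G"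
    "maximally_distant u v" "maximally_distant v u"
  shows "u = v \<or> u \<in> W \<or> v \<in> W"
  using assms strongly_resolves_maximally_distant unfolding strong_resolving_set_def by blast

end

text \<open>At most one member of \<open>T\<close> can lie outside \<open>W\<close>.\<close>

lemma (in wf_digraph) finite_maximally_distant_family:
  assumes "strong_resolving_set G W" "finite W" "T \<subseteq> verts G"
    and "\<And>u v. u \<in> T \<Longrightarrow> v \<in> T \<Longrightarrow> u \<noteq> v \<Longrightarrow> maximally_distant u v"
  shows "finite T"
proof (cases "T \<subseteq> W")
  case True
  then show ?thesis using assms(2) by (rule finite_subset)
next
  case False
  then obtain t where "t \<in> T" "t \<notin> W" by blast
  then have "T \<subseteq> insert t W"
    using strong_resolving_set_maximally_distant[OF assms(1)] assms(3,4) by blast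
  then show ?thesis using assms(2) by (meson finite_insert finite_subset)
qed

text \<open>Every neighbour of \<open>v\<close> is at distance 1 from \<open>u\<close>, while
  \<open>v\<close>, being distinct from \<open>u\<close>, is at distance at least 1.\<close>

lemma (in pair_wf_digraph) maximally_distant_twins:
  assumes "u \<noteq> v" and twins: "\<And>x. (v, x) \<in> parcs G \<Longrightarrow> (u, x) \<in> parcs G"
  shows "maximally_distant u v"
  unfolding maximally_distant_def
proof (intro ballI impI)
  fix e assume "e \<in> parcs G" "fst e = v"
  then have "(u, snd e) \<in> parcs G" using twins by (metis prod.collapse)
  then have "awalk u [(u, snd e)] (snd e)"
    by (simp add: awalk_simps in_arcsD1 in_arcsD2)
  moreover have "Suc 0 \<le> length p" if "awalk u p v" for p
    using that \<open>u \<noteq> v\<close> by (cases p) (simp_all add: awalk_simps)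
  ultimately show "\<exists>q. awalk u q (snd e) \<and> (\<forall>p. awalk u p v \<longrightarrow> length q \<le> length p)"
    by (intro exI[of _ "[(u, snd e)]"]) simp
qed

section \<open>Laminar families\<close>

definition laminar :: "'a set set \<Rightarrow> bool" where
  "laminar F \<longleftrightarrow> (\<forall>S\<in>F. \<forall>T\<in>F. S \<subseteq> T \<or> T \<subseteq> S \<or> S \<inter> T = {})"

lemma laminarD:
  "laminar F \<Longrightarrow> S \<in> F \<Longrightarrow> T \<in> F \<Longrightarrow> S \<subseteq> T \<or> T \<subseteq> S \<or> S \<inter> T = {}"
  by (auto simp: laminar_def)

lemma laminar_subset: "laminar F \<Longrightarrow> E \<subseteq> F \<Longrightarrow> laminar E"
  by (auto simp: laminar_def)

text \<open>Deleting a point \<open>x\<close> from all members keeps the family laminar and costs at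
  most two members: \<open>{x}\<close> becomes empty, and at most one set merges with another
  member.\<close>

lemma card_laminar_le:
  assumes "finite X" "laminar F" "F \<subseteq> Pow X - {{}}"
  shows "card F \<le> 2 * card X - 1"
  using assms
proof (induction X arbitrary: F rule: finite_induct)
  case empty
  then show ?case by auto
next
  case (insert x X)
  have fin: "finite F" using insert.prems(2) insert.hyps(1) by (auto intro: finite_subset)
  \<comment> \<open>\<open>F1\<close> holds the sets that would merge with another member. Without
    it deletion of \<open>x\<close> is injective, and without \<open>{x}\<close> all results are
    nonempty.\<close>
  define F1 where "F1 = {S \<in> F. x \<in> S \<and> S - {x} \<in> F}"
  define F2 where "F2 = F - F1 - {{x}}"
  define E where "E = (\<lambda>S. S - {x}) ` F2"
  have inj: "inj_on (\<lambda>S. S - {x}) F2"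
  proof (rule inj_onI)
    fix S T assume *: "S \<in> F2" "T \<in> F2" "S - {x} = T - {x}"
    have "x \<in> S \<longleftrightarrow> x \<in> T"
    proof (rule ccontr)
      assume "\<not> ?thesis"
      then consider "x \<in> S" "x \<notin> T" | "x \<notin> S" "x \<in> T" by blast
      then show False
        by cases (use * in \<open>auto simp: F2_def F1_def\<close>)
    qed
    with *(3) show "S = T" by blast
  qed
  have "laminar E"
    unfolding laminar_def
  proof (intro ballI)
    fix A B assume "A \<in> E" "B \<in> E"
    then obtain S T where "S \<in> F" "T \<in> F" "A = S - {x}" "B = T - {x}"
      by (auto simp: E_def F2_def)
    with laminarD[OF insert.prems(1), of S T] show "A \<subseteq> B \<or> B \<subseteq> A \<or> A \<inter> B = {}" by blast
  qed
  moreover have "E \<subseteq> Pow X - {{}}"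
    using insert.prems(2) by (auto simp: E_def F2_def)
  ultimately have E: "card E \<le> 2 * card X - 1" by (rule insert.IH)
  have F1: "card F1 \<le> 1"
  proof (rule card_le_Suc0_iff_eq[THEN iffD2, simplified One_nat_def[symmetric]])
    show "finite F1" using fin by (auto simp: F1_def)
    show "\<forall>S\<in>F1. \<forall>T\<in>F1. S = T"
    proof (intro ballI)
      fix S T assume *: "S \<in> F1" "T \<in> F1"
      then have F: "S \<in> F" "T \<in> F" "S - {x} \<in> F" "T - {x} \<in> F" "x \<in> S" "x \<in> T"
        by (auto simp: F1_def)
      have ne: "S - {x} \<noteq> {}" "T - {x} \<noteq> {}" using F insert.prems(2) by blast+
      \<comment> \<open>Two members of \<open>F1\<close> share \<open>x\<close>, so they are nested.
        If \<open>S\<close> is the smaller one, then \<open>T - {x}\<close> meets \<open>S\<close>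
        and misses \<open>x\<close>, so it lies in \<open>S\<close>, which gives
        \<open>S = T\<close>.\<close>
      from laminarD[OF insert.prems(1) F(1,2)] F(5,6) have "S \<subseteq> T \<or> T \<subseteq> S" by blast
      then show "S = T"
        using laminarD[OF insert.prems(1) F(1,4)] laminarD[OF insert.prems(1) F(2,3)] F(5,6) ne
        by blast
    qed
  qed
  have "card F \<le> card (F1 \<union> F2 \<union> {{x}})"
    using fin by (intro card_mono) (auto simp: F1_def F2_def)
  also have "\<dots> \<le> card F1 + card F2 + 1"
    using card_Un_le[of "F1 \<union> F2" "{{x}}"] card_Un_le[of F1 F2] by simp
  also have "card F2 = card E" using inj by (simp add: E_def card_image)
  finally have le: "card F \<le> card E + 2" using F1 by simp
  have card_ins: "card (insert x X) = card X + 1" using insert.hyps by simp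
  show ?case
  \<comment> \<open>For empty \<open>X\<close> the truncated bound \<open>2 * card X - 1\<close> is
    0 instead of -1, so the estimate by \<open>card E + 2\<close> would be off by one.\<close>
  proof (cases "X = {}")
    case True
    then have "F \<subseteq> {{x}}" using insert.prems(2) by auto
    then have "card F \<le> 1" using card_mono[of "{{x}}" F] by simp
    then show ?thesis using card_ins by linarith
  next
    case False
    then have "1 \<le> card X" using insert.hyps(1) by (simp add: Suc_le_eq card_gt_0_iff)
    then show ?thesis using le E card_ins by linarith
  qed
qed

text \<open>Each new point \<open>x\<close> contributes two members, \<open>{x}\<close> and the
  enlarged whole set. Membership of \<open>X\<close> is recorded because \<open>X\<close> is later
  discarded, which leaves \<open>2 * card X - 2\<close> proper subsets.\<close>

lemma ex_laminar_card:
  assumes "finite X" "X \<noteq> {}"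
  shows "\<exists>F. laminar F \<and> X \<in> F \<and> F \<subseteq> Pow X - {{}} \<and> card F = 2 * card X - 1"
  using assms
proof (induction X rule: finite_ne_induct)
  case (singleton x)
  then show ?case by (intro exI[of _ "{{x}}"]) (auto simp: laminar_def)
next
  case (insert x X)
  then obtain F where F: "laminar F" "X \<in> F" "F \<subseteq> Pow X - {{}}" "card F = 2 * card X - 1"
    by blast
  define E where "E = insert {x} (insert (insert x X) F)"
  have "finite F" using F(3) insert.hyps(1) by (auto intro: finite_subset)
  moreover have "{x} \<notin> F" "insert x X \<notin> F" "{x} \<noteq> insert x X"
    using F(3) insert.hyps by auto
  ultimately have "card E = card F + 2" by (simp add: E_def)
  moreover have "0 < card X" using insert.hyps by (simp add: card_gt_0_iff)
  ultimately have "card E = 2 * card (insert x X) - 1" using F(4) insert.hyps by simp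
  moreover have "laminar E"
    unfolding laminar_def
  proof (intro ballI)
    fix S T assume *: "S \<in> E" "T \<in> E"
    have "S \<in> F \<or> S = {x} \<or> S = insert x X" "T \<in> F \<or> T = {x} \<or> T = insert x X"
      using * by (auto simp: E_def)
    moreover have "A \<subseteq> X" if "A \<in> F" for A using that F(3) by blast
    ultimately show "S \<subseteq> T \<or> T \<subseteq> S \<or> S \<inter> T = {}"
      using laminarD[OF F(1), of S T] insert.hyps(3) by blast
  qed
  moreover have "insert x X \<in> E" "E \<subseteq> Pow (insert x X) - {{}}"
    using F(3) by (auto simp: E_def)
  ultimately show ?case by blast
qed

section \<open>Disjointness graphs\<close>

text \<open>The combinatorial model of the co-maximal ideal graph: \<open>h\<close> will be the hull
  of an ideal and \<open>X\<close> the set of maximal ideals. Values of \<open>h\<close> are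
  nonempty, so the formula for the arcs admits no loop.\<close>

locale disjointness_graph = pair_wf_digraph G
  for G :: "'v pair_pre_digraph" +
  fixes X :: "'x set" and h :: "'v \<Rightarrow> 'x set"
  assumes finite_X: "finite X"
    and bij_h: "bij_betw h (pverts G) (Pow X - {{}, X})"
    and parcs_eq: "parcs G = {(u, v). u \<in> pverts G \<and> v \<in> pverts G \<and> h u \<inter> h v = {}}"
begin

lemma h_vertex: "v \<in> pverts G \<Longrightarrow> h v \<subseteq> X \<and> h v \<noteq> {} \<and> h v \<noteq> X"
  using bij_betw_apply[OF bij_h, of v] by auto

lemma h_eq_iff: "u \<in> pverts G \<Longrightarrow> v \<in> pverts G \<Longrightarrow> h u = h v \<longleftrightarrow> u = v"
  using inj_on_eq_iff[OF bij_betw_imp_inj_on[OF bij_h]] by blast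

lemma ex_vertex:
  assumes "S \<subseteq> X" "S \<noteq> {}" "S \<noteq> X"
  obtains v where "v \<in> pverts G" "h v = S"
proof -
  have "S \<in> h ` pverts G" using assms bij_betw_imp_surj_on[OF bij_h] by auto
  with that show ?thesis by blast
qed

lemma ex_complement:
  assumes "v \<in> pverts G"
  obtains w where "w \<in> pverts G" "h w = X - h v"
  using ex_vertex[of "X - h v"] h_vertex[OF assms] by blast

lemma card_proper_subsets:
  assumes "X \<noteq> {}"
  shows "card (Pow X - {{}, X}) = 2 ^ card X - 2"
  using assms finite_X by (subst card_Diff_subset) (auto simp: card_Pow)

lemma finite_verts: "finite (pverts G)"
  using bij_betw_finite[OF bij_h] finite_X by simp

lemma card_verts: "X \<noteq> {} \<Longrightarrow> card (pverts G) = 2 ^ card X - 2"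
  using bij_betw_same_card[OF bij_h] card_proper_subsets by simp

lemma arc_iff: "(u, v) \<in> parcs G \<longleftrightarrow> u \<in> pverts G \<and> v \<in> pverts G \<and> h u \<inter> h v = {}"
  by (simp add: parcs_eq)

section \<open>Distances in the disjointness graph\<close>

lemma awalk_length_2I:
  assumes "awalk u p v" "u \<noteq> v" "h u \<inter> h v \<noteq> {}"
  shows "2 \<le> length p"
proof (rule ccontr)
  assume "\<not> ?thesis"
  then have "length p = 0 \<or> length p = 1" by linarith
  with assms show False
    by (auto simp: awalk_simps arc_iff length_Suc_conv)
qed

text \<open>The midpoint of a walk of length 2 would be disjoint from both \<open>h u\<close> and
  \<open>h v\<close>, hence empty.\<close>

lemma awalk_length_3I:
  assumes "awalk u p v" "u \<noteq> v" "h u \<inter> h v \<noteq> {}" "h u \<union> h v = X"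
  shows "3 \<le> length p"
proof (rule ccontr)
  assume "\<not> ?thesis"
  with awalk_length_2I[OF assms(1-3)] have "length p = 2" by linarith
  then obtain e f where "p = [e, f]" by (auto simp: numeral_2_eq_2 length_Suc_conv)
  with assms(1) obtain x where "(u, x) \<in> parcs G" "(x, v) \<in> parcs G"
    by (cases e, cases f) (auto simp: awalk_simps)
  then have "x \<in> pverts G" "h x \<inter> (h u \<union> h v) = {}" by (auto simp: arc_iff)
  with assms(4) show False using h_vertex[of x] by blast
qed

lemma awalk_1: "(u, v) \<in> parcs G \<Longrightarrow> awalk u [(u, v)] v"
  by (auto simp: awalk_simps arc_iff)

lemma awalk_2: "(u, v) \<in> parcs G \<Longrightarrow> (v, w) \<in> parcs G \<Longrightarrow> awalk u [(u, v), (v, w)] w"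
  by (auto simp: awalk_simps arc_iff)

lemma ex_awalk:
  assumes "u \<in> pverts G" "v \<in> pverts G"
  shows "\<exists>p. awalk u p v"
proof -
  obtain x where x: "x \<in> pverts G" "h x = X - h u" using ex_complement[OF assms(1)] .
  obtain y where y: "y \<in> pverts G" "h y = X - h v" using ex_complement[OF assms(2)] .
  consider "u = v" | "u \<noteq> v" "h u \<union> h v = X" | "h u \<union> h v \<noteq> X" by blast
  then show ?thesis
  proof cases
    case 1
    then show ?thesis using assms by (intro exI[of _ "[]"]) (simp add: awalk_Nil_iff)
  next
    case 2
    \<comment> \<open>The complements of \<open>h u\<close> and \<open>h v\<close> are disjoint
      because these sets cover \<open>X\<close>.\<close>
    then have "(u, x) \<in> parcs G" "(x, y) \<in> parcs G" "(y, v) \<in> parcs G"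
      using assms x y by (auto simp: arc_iff)
    then have "awalk u ([(u, x), (x, y)] @ [(y, v)]) v"
      using awalk_appendI awalk_2 awalk_1 by blast
    then show ?thesis by blast
  next
    case 3
    obtain z where z: "z \<in> pverts G" "h z = X - (h u \<union> h v)"
      using 3 h_vertex[OF assms(1)] h_vertex[OF assms(2)] ex_vertex[of "X - (h u \<union> h v)"] by blast
    then have "awalk u [(u, z), (z, v)] v"
      using assms by (intro awalk_2) (auto simp: arc_iff)
    then show ?thesis by blast
  qed
qed

lemma resolves_endpoint:
  assumes "u \<in> pverts G" "v \<in> pverts G"
  shows "strongly_resolves G u u v" "strongly_resolves G v u v"
  using ex_awalk[OF assms] ex_awalk[OF assms(2,1)] strongly_resolves_endpoint by blast+

section \<open>Strong resolving sets and laminar complements\<close>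

text \<open>The distance from \<open>u\<close> to \<open>v\<close> is at least 2. A neighbour of
  \<open>v\<close> misses the points of \<open>h v - h u\<close>, so it does not cover
  \<open>X\<close> together with \<open>h u\<close> and has a common neighbour with
  \<open>u\<close>.\<close>

lemma maximally_distant_if_crossing:
  assumes "u \<in> pverts G" "v \<in> pverts G" "h u \<inter> h v \<noteq> {}" "\<not> h v \<subseteq> h u"
  shows "maximally_distant u v"
  unfolding maximally_distant_def
proof (intro ballI impI)
  fix e assume "e \<in> parcs G" "fst e = v"
  then have e: "snd e \<in> pverts G" "h v \<inter> h (snd e) = {}"
    by (auto simp: parcs_eq)
  have short: "2 \<le> length p" if "awalk u p v" for p
    using awalk_length_2I[OF that] assms(3,4) by auto
  have "h u \<union> h (snd e) \<noteq> X"
    using e(2) assms(4) h_vertex[OF assms(2)] by blast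
  then obtain x where "x \<in> pverts G" "h x = X - (h u \<union> h (snd e))"
    using ex_vertex[of "X - (h u \<union> h (snd e))"] h_vertex[OF assms(1)] h_vertex[OF e(1)] by blast
  then have "awalk u [(u, x), (x, snd e)] (snd e)"
    using assms(1) e by (intro awalk_2) (auto simp: arc_iff)
  with short show "\<exists>q. awalk u q (snd e) \<and> (\<forall>p. awalk u p v \<longrightarrow> length q \<le> length p)"
    by (intro exI[of _ "[(u, x), (x, snd e)]"]) (auto simp: eval_nat_numeral)
qed

lemma laminar_if_strong_resolving_set:
  assumes "strong_resolving_set G W"
  shows "laminar (h ` (pverts G - W))"
  unfolding laminar_def
proof (intro ballI)
  fix S T assume "S \<in> h ` (pverts G - W)" "T \<in> h ` (pverts G - W)"
  then obtain u v where uv: "u \<in> pverts G - W" "v \<in> pverts G - W" "S = h u" "T = h v" by blast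
  show "S \<subseteq> T \<or> T \<subseteq> S \<or> S \<inter> T = {}"
  proof (rule ccontr)
    assume "\<not> ?thesis"
    with uv have "maximally_distant u v" "maximally_distant v u" "u \<noteq> v"
      by (auto intro!: maximally_distant_if_crossing)
    with strong_resolving_set_maximally_distant[OF assms, of u v] uv show False by simp
  qed
qed

text \<open>With \<open>S = h u\<close> and \<open>T = h v\<close>, the path \<open>T\<close>, \<open>X - T\<close>, \<open>S\<close>, \<open>X - S\<close> is shortest.\<close>

lemma resolves_nested:
  assumes "u \<in> pverts G" "v \<in> pverts G" "h u \<subset> h v" "w \<in> pverts G" "h w = X - h u"
  shows "strongly_resolves G w u v"
proof -
  obtain x where x: "x \<in> pverts G" "h x = X - h v" using ex_complement[OF assms(2)] .
  note h = h_vertex[OF assms(1)] h_vertex[OF assms(2)]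
  have "(v, x) \<in> parcs G" "(x, u) \<in> parcs G" "(u, w) \<in> parcs G"
    using assms x by (auto simp: arc_iff)
  then have "awalk v [(v, x), (x, u)] u" "awalk u [(u, w)] w" by (auto intro: awalk_1 awalk_2)
  moreover have "3 \<le> length r" if "awalk v r w" for r
    by (rule awalk_length_3I[OF that]) (use assms h in auto)
  ultimately show ?thesis by (intro strongly_resolvesI(2)) (auto simp: eval_nat_numeral)
qed

text \<open>With \<open>S = h u\<close> and \<open>T = h v\<close>, the path \<open>S\<close>, \<open>T\<close>, \<open>X - T\<close> is shortest.\<close>

lemma resolves_disjoint:
  assumes "u \<in> pverts G" "v \<in> pverts G" "h u \<inter> h v = {}" "h u \<union> h v \<noteq> X"
    and "w \<in> pverts G" "h w = X - h v"
  shows "strongly_resolves G w u v"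
proof -
  note h = h_vertex[OF assms(1)] h_vertex[OF assms(2)]
  have "(u, v) \<in> parcs G" "(v, w) \<in> parcs G" using assms by (auto simp: arc_iff)
  then have "awalk u [(u, v)] v" "awalk v [(v, w)] w" by (auto intro: awalk_1)
  moreover have "2 \<le> length r" if "awalk u r w" for r
    by (rule awalk_length_2I[OF that]) (use assms h in auto)
  ultimately show ?thesis by (intro strongly_resolvesI(1)) (auto simp: eval_nat_numeral)
qed

text \<open>With \<open>S = h u\<close>, the path \<open>S\<close>, \<open>X - S\<close>, \<open>A\<close>, \<open>X - A\<close> is shortest.\<close>

lemma resolves_complement:
  assumes "u \<in> pverts G" "v \<in> pverts G" "h v = X - h u" "A \<subset> h u" "A \<noteq> {}"
    and "w \<in> pverts G" "h w = X - A"
  shows "strongly_resolves G w u v"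
proof -
  note h = h_vertex[OF assms(1)] h_vertex[OF assms(2)]
  obtain x where x: "x \<in> pverts G" "h x = A" using ex_vertex[of A] assms(4,5) h by blast
  have "(u, v) \<in> parcs G" "(v, x) \<in> parcs G" "(x, w) \<in> parcs G"
    using assms x by (auto simp: arc_iff)
  then have "awalk u [(u, v)] v" "awalk v [(v, x), (x, w)] w" by (auto intro: awalk_1 awalk_2)
  moreover have "3 \<le> length r" if "awalk u r w" for r
    by (rule awalk_length_3I[OF that]) (use assms h in auto)
  ultimately show ?thesis by (intro strongly_resolvesI(1)) (auto simp: eval_nat_numeral)
qed

text \<open>For two vertices outside \<open>W\<close>, the resolving vertex is the complement of a
  suitable set. It crosses a vertex outside \<open>W\<close>, or one of two crossing candidates is
  chosen, and laminarity puts it into \<open>W\<close>.\<close>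

lemma strong_resolving_set_if_laminar:
  assumes card: "3 \<le> card X" and W: "W \<subseteq> pverts G" and lam: "laminar (h ` (pverts G - W))"
  shows "strong_resolving_set G W"
  unfolding strong_resolving_set_def with_proj_simps
proof (intro conjI ballI impI W)
  fix u v assume uv: "u \<in> pverts G" "v \<in> pverts G" "u \<noteq> v"
  have crossing: "x \<in> W \<or> y \<in> W"
    if "x \<in> pverts G" "y \<in> pverts G" "\<not> h x \<subseteq> h y" "\<not> h y \<subseteq> h x" "h x \<inter> h y \<noteq> {}" for x y
    using laminarD[OF lam, of "h x" "h y"] that by blast
  have swap: "strongly_resolves G w a b \<Longrightarrow> strongly_resolves G w b a" for w a b
    by (auto simp: strongly_resolves_def)
  have nested: "\<exists>w\<in>W. strongly_resolves G w a b"
    if ab: "a \<in> pverts G" "b \<in> pverts G" "b \<notin> W" "h a \<subset> h b" for a b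
  proof -
    obtain w where w: "w \<in> pverts G" "h w = X - h a" using ex_complement[OF ab(1)] .
    have "w \<in> W \<or> b \<in> W"
      by (rule crossing) (use ab w h_vertex[OF ab(1)] h_vertex[OF ab(2)] in auto)
    then show ?thesis using resolves_nested[OF ab(1,2,4) w] ab(3) by blast
  qed
  have complement: "\<exists>w\<in>W. strongly_resolves G w a b"
    if ab: "a \<in> pverts G" "b \<in> pverts G" "a \<notin> W" "h b = X - h a" "1 < card (h a)" for a b
  proof -
    note h = h_vertex[OF ab(1)] h_vertex[OF ab(2)]
    from h obtain x where x: "x \<in> h a" by blast
    have "{x} \<noteq> h a" using ab(5) by (metis card_1_singleton_iff less_irrefl One_nat_def)
    with x have A: "{x} \<subset> h a" by blast
    then obtain w where w: "w \<in> pverts G" "h w = X - {x}"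
      using ex_vertex[of "X - {x}"] h x by blast
    have "w \<in> W \<or> a \<in> W" by (rule crossing) (use ab w A h in auto)
    then show ?thesis using resolves_complement[OF ab(1,2,4) A _ w] ab(3) by blast
  qed
  show "\<exists>w\<in>W. strongly_resolves G w u v"
  proof (cases "u \<in> W \<or> v \<in> W")
    case True
    then show ?thesis using resolves_endpoint[OF uv(1,2)] by blast
  next
    case False
    then have "h u \<subseteq> h v \<or> h v \<subseteq> h u \<or> h u \<inter> h v = {}"
      using laminarD[OF lam] uv by blast
    moreover have "h u \<noteq> h v" using uv h_eq_iff by simp
    ultimately consider "h u \<subset> h v" | "h v \<subset> h u"
      | "h u \<inter> h v = {}" "h u \<union> h v \<noteq> X" | "h u \<inter> h v = {}" "h u \<union> h v = X"
      by blast
    then show ?thesis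
    proof cases
      case 1
      then show ?thesis using nested uv False by blast
    next
      case 2
      then show ?thesis using nested uv False swap by blast
    next
      case 3
      obtain x where x: "x \<in> pverts G" "h x = X - h u" using ex_complement[OF uv(1)] .
      obtain y where y: "y \<in> pverts G" "h y = X - h v" using ex_complement[OF uv(2)] .
      \<comment> \<open>The two complements meet outside \<open>h u \<union> h v\<close> and are
        incomparable because \<open>h u\<close> and \<open>h v\<close> are disjoint and
        nonempty.\<close>
      have "x \<in> W \<or> y \<in> W"
        by (rule crossing) (use 3 x y h_vertex[OF uv(1)] h_vertex[OF uv(2)] in auto)
      moreover have "strongly_resolves G y u v" by (rule resolves_disjoint) (use uv 3 y in auto)
      moreover have "strongly_resolves G x v u" by (rule resolves_disjoint) (use uv 3 x in auto)
      ultimately show ?thesis using swap by blast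
    next
      case 4
      then have c: "h v = X - h u" "h u = X - h v"
        using h_vertex[OF uv(1)] h_vertex[OF uv(2)] by auto
      have "card (h u) + card (h v) = card X"
        using 4 finite_X by (metis card_Un_disjoint finite_Un)
      \<comment> \<open>With at least three points, one of two complementary sets has a nonempty
        proper subset, as \<open>resolves_complement\<close> demands.\<close>
      with card have "1 < card (h u) \<or> 1 < card (h v)" by linarith
      then show ?thesis using complement[of u v] complement[of v u] uv c False swap by blast
    qed
  qed
qed

section \<open>Minimum size of a strong resolving set\<close>

lemma card_strong_resolving_set_ge:
  assumes "X \<noteq> {}" "strong_resolving_set G W"
  shows "2 ^ card X - 2 * card X \<le> card W"
proof -
  have W: "W \<subseteq> pverts G" using assms(2) by (simp add: strong_resolving_set_def)
  define L where "L = h ` (pverts G - W)"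
  have "inj_on h (pverts G - W)" using bij_h by (auto simp: bij_betw_def intro: inj_on_subset)
  then have L: "card L = 2 ^ card X - 2 - card W"
    using W finite_verts assms(1)
    by (simp add: L_def card_image card_Diff_subset finite_subset card_verts)
  have sub: "L \<subseteq> Pow X - {{}, X}" using h_vertex by (auto simp: L_def)
  \<comment> \<open>Adjoining \<open>X\<close>, which is not in \<open>L\<close>, keeps the family
    laminar and improves the bound for \<open>L\<close> by one.\<close>
  have "laminar (insert X L)"
    using laminar_if_strong_resolving_set[OF assms(2)] sub
    by (auto simp: L_def[symmetric] laminar_def)
  then have "card (insert X L) \<le> 2 * card X - 1"
    by (rule card_laminar_le[OF finite_X]) (use sub assms(1) in auto)
  moreover have "card (insert X L) = card L + 1"
  proof -
    have "X \<notin> L" "finite L" using sub finite_X finite_subset[OF sub] by auto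
    then show ?thesis by simp
  qed
  ultimately show ?thesis using L by linarith
qed

lemma ex_strong_resolving_set:
  assumes "3 \<le> card X"
  shows "\<exists>W. strong_resolving_set G W \<and> card W = 2 ^ card X - 2 * card X"
proof -
  have X: "X \<noteq> {}" using assms by auto
  obtain F where F: "laminar F" "X \<in> F" "F \<subseteq> Pow X - {{}}" "card F = 2 * card X - 1"
    using ex_laminar_card[OF finite_X X] by blast
  \<comment> \<open>The vertices outside \<open>W\<close> realise a laminar family of maximal size;
    its member \<open>X\<close> belongs to no vertex.\<close>
  define W where "W = {v \<in> pverts G. h v \<notin> F}"
  have eq: "h ` (pverts G - W) = F - {X}"
  proof
    show "h ` (pverts G - W) \<subseteq> F - {X}" using h_vertex by (auto simp: W_def)
    show "F - {X} \<subseteq> h ` (pverts G - W)"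
    proof
      fix S assume "S \<in> F - {X}"
      moreover from this F(3) obtain v where "v \<in> pverts G" "h v = S"
        using ex_vertex[of S] by blast
      ultimately show "S \<in> h ` (pverts G - W)" by (auto simp: W_def)
    qed
  qed
  have "inj_on h (pverts G - W)" using bij_h by (auto simp: bij_betw_def intro: inj_on_subset)
  then have "card (pverts G - W) = card (F - {X})" using eq by (metis card_image)
  also have "\<dots> = 2 * card X - 2" using F(2,4) by simp
  finally have "card (pverts G) - card W = 2 * card X - 2"
    using finite_verts by (simp add: card_Diff_subset W_def)
  moreover have "card W \<le> card (pverts G)" using finite_verts by (auto simp: W_def intro: card_mono)
  ultimately have "card W = 2 ^ card X - 2 * card X" using card_verts[OF X] assms by linarith
  moreover have "strong_resolving_set G W"
  proof (rule strong_resolving_set_if_laminar[OF assms])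
    show "W \<subseteq> pverts G" by (auto simp: W_def)
    show "laminar (h ` (pverts G - W))" unfolding eq using F(1) by (rule laminar_subset) blast
  qed
  ultimately show ?thesis by blast
qed

lemma strong_resolving_set_finite: "strong_resolving_set G W \<Longrightarrow> finite W"
  using finite_verts by (auto simp: strong_resolving_set_def intro: finite_subset)

lemma sdim_eqI:
  assumes "strong_resolving_set G W" "\<And>W'. strong_resolving_set G W' \<Longrightarrow> card W \<le> card W'"
  shows "sdim G = enat (card W)"
  unfolding sdim_def
proof (rule antisym)
  show "(INF W \<in> {W. strong_resolving_set G W}. ecard W) \<le> enat (card W)"
    using assms(1) strong_resolving_set_finite by (intro INF_lower2[of W]) (auto simp: ecard_def)
  show "enat (card W) \<le> (INF W \<in> {W. strong_resolving_set G W}. ecard W)"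
    using assms(2) by (intro INF_greatest) (auto simp: ecard_def)
qed

lemma sdim_eq:
  assumes "3 \<le> card X"
  shows "sdim G = enat (2 ^ card X - 2 * card X)"
proof -
  have "X \<noteq> {}" using assms by auto
  obtain W where W: "strong_resolving_set G W" "card W = 2 ^ card X - 2 * card X"
    using ex_strong_resolving_set[OF assms] by blast
  then show ?thesis
    using sdim_eqI[OF W(1)] card_strong_resolving_set_ge[OF \<open>X \<noteq> {}\<close>] by simp
qed

text \<open>Only two vertices exist, the two complementary singletons. The general formula would
  give 0 here, but this pair still needs a resolving vertex.\<close>

lemma sdim_eq_1:
  assumes "card X = 2"
  shows "sdim G = 1"
proof -
  have X: "X \<noteq> {}" using assms by auto
  have "card (pverts G) = 2" using card_verts[OF X] assms by simp
  then obtain u v where uv: "pverts G = {u, v}" "u \<noteq> v" by (auto simp: card_2_iff)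
  have "strong_resolving_set G {u}"
    using uv resolves_endpoint[of u v] resolves_endpoint[of v u]
    by (auto simp: strong_resolving_set_def)
  moreover have "card {u} \<le> card W" if "strong_resolving_set G W" for W
    using that uv strong_resolving_set_finite[OF that]
    by (auto simp: strong_resolving_set_def Suc_le_eq card_gt_0_iff)
  ultimately have "sdim G = enat (card {u})" by (rule sdim_eqI)
  then show ?thesis by (simp add: one_enat_def)
qed

end

section \<open>Hulls of ideals\<close>

lemma sdim_finiteE:
  assumes "sdim G \<noteq> \<infinity>"
  obtains W where "strong_resolving_set G W" "finite W"
proof -
  have "\<exists>W. strong_resolving_set G W \<and> ecard W \<noteq> \<infinity>"
  proof (rule ccontr)
    assume "\<not> ?thesis"
    then have "sdim G = \<infinity>"
      unfolding sdim_def by (intro INF_eqI) (simp_all add: top_enat_def[symmetric] top_unique)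
    with assms show False by simp
  qed
  with that show ?thesis by (auto simp: ecard_def split: if_splits)
qed

text \<open>The closed set V(I) of the maximal spectrum.\<close>

definition ideal_hull :: "('a, 'r) ring_scheme \<Rightarrow> 'a set \<Rightarrow> 'a set set" where
  "ideal_hull R I = {M \<in> Max_ideals R. I \<subseteq> M}"

context cring
begin

lemma Max_idealsD:
  assumes "M \<in> Max_ideals R"
  shows "maximalideal M R" "ideal M R" "primeideal M R" "\<one> \<notin> M"
proof -
  show max: "maximalideal M R" using assms by (simp add: Max_ideals_def)
  then show id: "ideal M R" by (simp add: maximalideal.axioms(1))
  show "primeideal M R" using max by (rule maximalideal_prime)
  show "\<one> \<notin> M"
    using ideal.one_imp_carrier[OF id] maximalideal.I_notcarr[OF max] by blast
qed

lemma ex_Max_ideal: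
  assumes "ideal I R" "I \<noteq> carrier R"
  shows "\<exists>M \<in> Max_ideals R. I \<subseteq> M"
proof -
  \<comment> \<open>Properness is expressed as \<open>\<one> \<notin> J\<close>, which passes to
    unions of chains, so Zorn's lemma applies.\<close>
  define A where "A = {J. ideal J R \<and> I \<subseteq> J \<and> \<one> \<notin> J}"
  have "I \<in> A" using assms ideal.one_imp_carrier by (auto simp: A_def)
  moreover have "\<Union>C \<in> A" if C: "C \<noteq> {}" "subset.chain A C" for C
  proof -
    have "C \<subseteq> A" using C(2) by (simp add: subset_chain_def)
    moreover have "subset.chain {J. ideal J R} C"
      using C(2) unfolding subset_chain_def A_def by blast
    then have "ideal (\<Union>C) R" using chain_Union_is_ideal[of C] C(1) by simp
    ultimately show ?thesis using C(1) unfolding A_def by blast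
  qed
  ultimately obtain M where M: "M \<in> A" and max: "\<And>J. J \<in> A \<Longrightarrow> M \<subseteq> J \<Longrightarrow> J = M"
    using subset_Zorn_nonempty[of A] by blast
  have "maximalideal M R"
  proof (rule maximalidealI)
    show "ideal M R" using M by (simp add: A_def)
    show "carrier R \<noteq> M" using M by (auto simp: A_def)
    fix J assume J: "ideal J R" "M \<subseteq> J" "J \<subseteq> carrier R"
    show "J = M \<or> J = carrier R"
    proof (cases "\<one> \<in> J")
      case True
      then show ?thesis using ideal.one_imp_carrier[OF J(1)] by simp
    next
      case False
      then have "J \<in> A" using J M by (auto simp: A_def)
      then show ?thesis using max J by blast
    qed
  qed
  then show ?thesis using M by (auto simp: A_def Max_ideals_def)
qed

section \<open>Vertices and arcs in terms of hulls\<close>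

lemma ideal_hull_empty_iff:
  assumes "ideal I R"
  shows "ideal_hull R I = {} \<longleftrightarrow> I = carrier R"
  using ex_Max_ideal[OF assms] Max_idealsD(4) by (auto simp: ideal_hull_def)

lemma ideal_sum_upper:
  assumes "ideal I R" "ideal J R"
  shows "I \<subseteq> I <+>\<^bsub>R\<^esub> J" "J \<subseteq> I <+>\<^bsub>R\<^esub> J"
proof -
  interpret I: ideal I R by fact
  interpret J: ideal J R by fact
  have "x \<oplus> \<zero> \<in> I <+>\<^bsub>R\<^esub> J" if "x \<in> I" for x
    using that J.zero_closed unfolding set_add_def' by blast
  then show "I \<subseteq> I <+>\<^bsub>R\<^esub> J" using I.Icarr by auto
  have "\<zero> \<oplus> x \<in> I <+>\<^bsub>R\<^esub> J" if "x \<in> J" for x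
    using that I.zero_closed unfolding set_add_def' by blast
  then show "J \<subseteq> I <+>\<^bsub>R\<^esub> J" using J.Icarr by auto
qed

lemma ideal_sum_least:
  assumes "ideal K R" "I \<subseteq> K" "J \<subseteq> K"
  shows "I <+>\<^bsub>R\<^esub> J \<subseteq> K"
  using assms additive_subgroup.a_closed[OF ideal.axioms(1)[OF assms(1)]]
  unfolding set_add_def' by blast

text \<open>A maximal ideal contains the sum iff it contains both summands, and only the whole ring
  has an empty hull.\<close>

lemma ideal_sum_eq_carrier_iff:
  assumes "ideal I R" "ideal J R"
  shows "I <+>\<^bsub>R\<^esub> J = carrier R \<longleftrightarrow> ideal_hull R I \<inter> ideal_hull R J = {}"
proof -
  have "ideal_hull R (I <+>\<^bsub>R\<^esub> J) = ideal_hull R I \<inter> ideal_hull R J"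
    using ideal_sum_upper[OF assms] ideal_sum_least[OF Max_idealsD(2)]
    unfolding ideal_hull_def by blast
  then show ?thesis using ideal_hull_empty_iff[OF add_ideals[OF assms]] by simp
qed

lemma ideal_subset_jacobson_iff:
  assumes "ideal I R"
  shows "I \<subseteq> jacobson_radical R \<longleftrightarrow> ideal_hull R I = Max_ideals R"
  using ideal.Icarr[OF assms] by (auto simp: jacobson_radical_def ideal_hull_def)

lemma comaximal_vertices_iff:
  "I \<in> comaximal_vertices R \<longleftrightarrow>
     ideal I R \<and> ideal_hull R I \<noteq> {} \<and> ideal_hull R I \<noteq> Max_ideals R"
  using ideal_hull_empty_iff ideal_subset_jacobson_iff
  unfolding comaximal_vertices_def by blast

lemma comaximal_arcs_eq:
  "parcs (comaximal_ideal_graph R) =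
     {(I, J). I \<in> comaximal_vertices R \<and> J \<in> comaximal_vertices R \<and>
       ideal_hull R I \<inter> ideal_hull R J = {}}"
proof -
  have "(I \<noteq> J \<and> I <+>\<^bsub>R\<^esub> J = carrier R) \<longleftrightarrow> ideal_hull R I \<inter> ideal_hull R J = {}"
    if "I \<in> comaximal_vertices R" "J \<in> comaximal_vertices R" for I J
    using that ideal_sum_eq_carrier_iff[of I J] unfolding comaximal_vertices_iff by blast
  then show ?thesis unfolding comaximal_ideal_graph_def by auto
qed

lemma pverts_comaximal: "pverts (comaximal_ideal_graph R) = comaximal_vertices R"
  by (simp add: comaximal_ideal_graph_def)

lemma ideal_hull_cgenideal:
  assumes "x \<in> carrier R"
  shows "ideal_hull R (PIdl x) = {M \<in> Max_ideals R. x \<in> M}"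
  using cgenideal_self[OF assms] cgenideal_minimal[OF Max_idealsD(2)]
  unfolding ideal_hull_def by blast

section \<open>Powers of an element and von Neumann regularity\<close>

lemma Max_ideal_nat_pow_iff:
  assumes "M \<in> Max_ideals R" "x \<in> carrier R"
  shows "x [^] Suc k \<in> M \<longleftrightarrow> x \<in> M"
proof (induction k)
  case 0
  then show ?case using assms by simp
next
  case (Suc k)
  interpret primeideal M R using assms(1) by (rule Max_idealsD)
  have "x [^] Suc (Suc k) = x [^] Suc k \<otimes> x" by simp
  moreover have "x [^] Suc k \<in> carrier R" using assms(2) by blast
  ultimately show ?case
    using I_prime[of "x [^] Suc k" x] I_l_closed[of x "x [^] Suc k"] assms(2) Suc.IH by metis
qed

lemma ideal_hull_nat_pow:
  assumes "x \<in> carrier R"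
  shows "ideal_hull R (PIdl (x [^] Suc k)) = ideal_hull R (PIdl x)"
  using ideal_hull_cgenideal[OF assms] ideal_hull_cgenideal[of "x [^] Suc k"] assms
    Max_ideal_nat_pow_iff[OF _ assms, of _ k]
  by auto

text \<open>With \<open>p = x [^] Suc j\<close>, equality of the ideals gives
  \<open>p = p \<otimes> s \<otimes> x\<close>, so \<open>t = \<one> \<ominus> s \<otimes> x\<close>
  kills \<open>p\<close>. Then \<open>x \<otimes> t\<close> is nilpotent, hence zero.\<close>

lemma regular_if_power_ideals_eq:
  assumes red: "reduced_ring R" and x: "x \<in> carrier R"
    and "j < k" and eq: "PIdl (x [^] Suc j) = PIdl (x [^] Suc k)"
  shows "\<exists>y \<in> carrier R. x = x \<otimes> x \<otimes> y"
proof -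
  obtain d where d: "Suc k = Suc j + Suc d" using \<open>j < k\<close> less_imp_Suc_add by fastforce
  define p where "p = x [^] Suc j"
  define q where "q = x [^] d"
  have pq: "p \<in> carrier R" "q \<in> carrier R" using x by (simp_all add: p_def q_def)
  have "x [^] Suc k = p \<otimes> (q \<otimes> x)"
    unfolding d p_def q_def using nat_pow_mult[OF x, of "Suc j" "Suc d"] by simp
  moreover have "p \<in> PIdl (x [^] Suc k)" using cgenideal_self[of p] pq eq by (simp add: p_def)
  ultimately obtain r where r: "r \<in> carrier R" "p = r \<otimes> (p \<otimes> (q \<otimes> x))"
    by (auto simp: cgenideal_def)
  define s where "s = r \<otimes> q"
  have s: "s \<in> carrier R" using r pq by (simp add: s_def)
  have "p \<otimes> (\<one> \<ominus> s \<otimes> x) = p \<ominus> r \<otimes> (p \<otimes> (q \<otimes> x))"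
    using pq r(1) x unfolding s_def by algebra
  also have "\<dots> = \<zero>" using r(2) pq(1) r_neg by (simp add: minus_eq)
  finally have zero: "p \<otimes> (\<one> \<ominus> s \<otimes> x) = \<zero>" .
  define t where "t = \<one> \<ominus> s \<otimes> x"
  have t: "t \<in> carrier R" using s x by (simp add: t_def)
  have "(x \<otimes> t) [^] Suc j = p \<otimes> t [^] Suc j"
    unfolding p_def using x t by (rule nat_pow_distrib)
  also have "\<dots> = (p \<otimes> t) \<otimes> t [^] j" using pq t by (simp add: m_ac)
  also have "\<dots> = \<zero>" using zero t by (simp add: t_def)
  finally have "x \<otimes> t = \<zero>"
    using red x t unfolding reduced_ring_def by blast
  moreover have "x \<otimes> x \<otimes> s = x \<ominus> x \<otimes> t" unfolding t_def using x s by algebra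
  ultimately have "x = x \<otimes> x \<otimes> s" using x by (simp add: minus_eq)
  then show ?thesis using s by blast
qed

lemma regular_if_sdim_finite:
  assumes red: "reduced_ring R" and fin: "sdim (with_proj (comaximal_ideal_graph R)) \<noteq> \<infinity>"
    and x: "x \<in> carrier R" "x \<notin> jacobson_radical R"
  shows "\<exists>y \<in> carrier R. x = x \<otimes> x \<otimes> y"
\<comment> \<open>If \<open>x\<close> is a unit, its principal ideal is no vertex, but its inverse
  is the required element.\<close>
proof (cases "PIdl x = carrier R")
  case True
  then obtain y where y: "y \<in> carrier R" "\<one> = y \<otimes> x"
    unfolding cgenideal_def using one_closed by blast
  have "x = x \<otimes> (y \<otimes> x)" using x(1) y(2)[symmetric] by simp
  also have "\<dots> = x \<otimes> x \<otimes> y" using x(1) y(1) by (simp add: m_ac)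
  finally show ?thesis using y(1) by blast
next
  case False
  interpret G: pair_bidirected_digraph "comaximal_ideal_graph R"
    by (rule comaximal_ideal_graph_bidirected)
  define P where "P k = PIdl (x [^] Suc k)" for k
  have P: "ideal (P k) R" "ideal_hull R (P k) = ideal_hull R (PIdl x)" for k
    using x(1) cgenideal_ideal nat_pow_closed ideal_hull_nat_pow unfolding P_def by blast+
  have hull: "ideal_hull R (PIdl x) \<noteq> {}" "ideal_hull R (PIdl x) \<noteq> Max_ideals R"
    using False ideal_hull_empty_iff ideal_subset_jacobson_iff cgenideal_ideal[OF x(1)]
      cgenideal_self[OF x(1)] x(2) by blast+
  then have vert: "P k \<in> comaximal_vertices R" for k
    unfolding comaximal_vertices_iff P(2) using P(1) by blast
  have "\<not> inj P"
  proof
    assume "inj P"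
    obtain W where W: "strong_resolving_set (with_proj (comaximal_ideal_graph R)) W" "finite W"
      using fin by (rule sdim_finiteE)
    \<comment> \<open>The vertices \<open>P k\<close> all have the same hull, so distinct ones are
      twins.\<close>
    have "finite (range P)"
    proof (rule G.finite_maximally_distant_family[OF W])
      show "range P \<subseteq> pverts (comaximal_ideal_graph R)"
        using vert by (auto simp: pverts_comaximal)
      fix u v assume "u \<in> range P" "v \<in> range P" "u \<noteq> v"
      then obtain i j where "u = P i" "v = P j" "P i \<noteq> P j" by blast
      then show "G.maximally_distant u v"
        by (intro G.maximally_distant_twins) (simp_all add: comaximal_arcs_eq P vert)
    qed
    then show False using finite_imageD[OF _ \<open>inj P\<close>] by simp
  qed
  then obtain i j where "P i = P j" "i < j"
    unfolding inj_def by (metis linorder_neqE_nat)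
  then show ?thesis using regular_if_power_ideals_eq[OF red x(1)] unfolding P_def by blast
qed

text \<open>The idempotent \<open>f = \<one> \<ominus> x \<otimes> y\<close> kills \<open>x\<close>
  and lies in no maximal ideal containing \<open>x\<close>, so \<open>I\<close> and \<open>f\<close>
  generate the ring. Multiplying \<open>\<one> = i \<oplus> r \<otimes> f\<close> by
  \<open>x\<close> gives \<open>x = x \<otimes> i\<close>.\<close>

lemma regular_in_ideal_if_in_hull:
  assumes I: "ideal I R" and x: "x \<in> carrier R" and y: "y \<in> carrier R" "x = x \<otimes> x \<otimes> y"
    and hull: "\<And>M. M \<in> ideal_hull R I \<Longrightarrow> x \<in> M"
  shows "x \<in> I"
proof -
  interpret ideal I R by fact
  define f where "f = \<one> \<ominus> x \<otimes> y"
  have f: "f \<in> carrier R" using x y by (simp add: f_def)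
  have "x \<otimes> f = x \<ominus> x \<otimes> x \<otimes> y" unfolding f_def using x y(1) by algebra
  then have xf: "x \<otimes> f = \<zero>" using y(2) x r_neg by (simp add: minus_eq)
  have "f \<notin> M" if M: "M \<in> Max_ideals R" "x \<in> M" for M
  proof
    assume "f \<in> M"
    interpret M: ideal M R using M(1) by (rule Max_idealsD)
    have "x \<otimes> y \<in> M" using M(2) y(1) by (rule M.I_r_closed)
    with \<open>f \<in> M\<close> have "f \<oplus> x \<otimes> y \<in> M" by (rule M.a_closed)
    moreover have "f \<oplus> x \<otimes> y = \<one>" unfolding f_def using x y(1) by algebra
    ultimately show False using Max_idealsD(4)[OF M(1)] by simp
  qed
  then have "ideal_hull R I \<inter> ideal_hull R (PIdl f) = {}"
    using hull ideal_hull_cgenideal[OF f] by (auto simp: ideal_hull_def)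
  then have "I <+>\<^bsub>R\<^esub> PIdl f = carrier R"
    using ideal_sum_eq_carrier_iff[OF I cgenideal_ideal[OF f]] by simp
  then obtain i r where i: "i \<in> I" "r \<in> carrier R" "\<one> = i \<oplus> r \<otimes> f"
    unfolding set_add_def' cgenideal_def using one_closed by blast
  have ic: "i \<in> carrier R" using i(1) by (rule Icarr)
  have "x = x \<otimes> (i \<oplus> r \<otimes> f)" using i(3)[symmetric] x by simp
  also have "\<dots> = x \<otimes> i \<oplus> r \<otimes> (x \<otimes> f)" using x ic i(2) f by algebra
  also have "\<dots> = x \<otimes> i" using xf x ic i(2) by simp
  finally show ?thesis using I_l_closed[OF i(1) x] by simp
qed

lemma vertex_eq_Inter_hull:
  assumes "reduced_ring R" "sdim (with_proj (comaximal_ideal_graph R)) \<noteq> \<infinity>"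
    and V: "I \<in> comaximal_vertices R"
  shows "I = \<Inter> (ideal_hull R I)"
proof
  show "I \<subseteq> \<Inter> (ideal_hull R I)" by (auto simp: ideal_hull_def)
  have I: "ideal I R" and "ideal_hull R I \<noteq> {}" using V by (simp_all add: comaximal_vertices_iff)
  \<comment> \<open>A nonempty hull keeps its intersection inside the carrier.\<close>
  then obtain M where M: "M \<in> ideal_hull R I" by blast
  interpret I: ideal I R by fact
  have regular: "x \<in> I"
    if "x \<in> \<Inter> (ideal_hull R I)" "x \<in> carrier R" "x \<notin> jacobson_radical R" for x
    using regular_if_sdim_finite[OF assms(1,2) that(2,3)] regular_in_ideal_if_in_hull[OF I that(2)] that(1)
    by blast
  show "\<Inter> (ideal_hull R I) \<subseteq> I"
  proof
    fix x assume hull: "x \<in> \<Inter> (ideal_hull R I)"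
    then have x: "x \<in> carrier R"
      using M ideal.Icarr[OF Max_idealsD(2)] by (auto simp: ideal_hull_def)
    show "x \<in> I"
    proof (cases "x \<in> jacobson_radical R")
      case False
      then show ?thesis using regular hull x by blast
    next
      case True
      \<comment> \<open>Regularity is known only outside the Jacobson radical, so \<open>x\<close>
        is shifted out of it by an element \<open>i\<close> of \<open>I\<close>; then
        \<open>i \<oplus> x\<close> lies in \<open>I\<close>, and so does \<open>x\<close>.\<close>
      obtain i where i: "i \<in> I" "i \<notin> jacobson_radical R"
        using V by (auto simp: comaximal_vertices_def)
      have ic: "i \<in> carrier R" using i(1) by (rule I.Icarr)
      have diff: "(i \<oplus> x) \<ominus> x = i" "(i \<oplus> x) \<ominus> i = x" using ic x by algebra+
      obtain N where N: "N \<in> Max_ideals R" "i \<notin> N"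
        using i(2) ic by (auto simp: jacobson_radical_def)
      interpret N: ideal N R using N(1) by (rule Max_idealsD)
      have "x \<in> N" using True N(1) by (auto simp: jacobson_radical_def)
      then have "i \<oplus> x \<notin> N"
        using N(2) diff(1) N.a_closed N.a_inv_closed unfolding minus_eq by metis
      then have "i \<oplus> x \<notin> jacobson_radical R" using N(1) by (auto simp: jacobson_radical_def)
      moreover have "i \<oplus> x \<in> K" if "K \<in> ideal_hull R I" for K
      proof -
        interpret K: ideal K R using that Max_idealsD(2) by (simp add: ideal_hull_def)
        have "i \<in> K" using that i(1) by (auto simp: ideal_hull_def)
        then show ?thesis using hull that by (intro K.a_closed) blast+
      qed
      ultimately have "i \<oplus> x \<in> I" using regular[of "i \<oplus> x"] x ic by blast
      then show ?thesis using diff(2) i(1) I.a_closed I.a_inv_closed unfolding minus_eq by metis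
    qed
  qed
qed

section \<open>Finite sets of maximal ideals as hulls\<close>

text \<open>The witness is a product of elements, one from each \<open>N\<close> in \<open>S\<close>
  and outside \<open>M\<close>; it avoids \<open>M\<close> because \<open>M\<close> is
  prime.\<close>

lemma ex_separating_element:
  assumes "finite S" "S \<subseteq> Max_ideals R" "M \<in> Max_ideals R" "M \<notin> S"
  shows "\<exists>x \<in> carrier R. x \<notin> M \<and> (\<forall>N\<in>S. x \<in> N)"
  using assms
proof (induction S rule: finite_induct)
  case empty
  then show ?case using Max_idealsD(4) one_closed by blast
next
  case (insert N S)
  then obtain x where x: "x \<in> carrier R" "x \<notin> M" "\<forall>N\<in>S. x \<in> N" by blast
  have N: "N \<in> Max_ideals R" "N \<noteq> M" using insert.prems by blast+
  interpret M: primeideal M R using insert.prems(2) by (rule Max_idealsD)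
  interpret N: maximalideal N R using N(1) by (rule Max_idealsD)
  have "\<not> N \<subseteq> M"
    using N.I_maximal[OF M.is_ideal] M.a_subset M.I_notcarr N(2) by blast
  then obtain y where y: "y \<in> N" "y \<notin> M" by blast
  have yc: "y \<in> carrier R" using y(1) by (rule N.Icarr)
  have "y \<otimes> x \<notin> M" using M.I_prime[OF yc x(1)] x(2) y(2) by blast
  moreover have "y \<otimes> x \<in> K" if "K \<in> insert N S" for K
  proof -
    have "ideal K R" using that insert.prems(1) Max_idealsD(2) by blast
    then show ?thesis
      using that y(1) yc x ideal.I_l_closed ideal.I_r_closed by (metis insertE)
  qed
  ultimately show ?case using x(1) yc by blast
qed

lemma ideal_hull_Inter:
  assumes "finite S" "S \<subseteq> Max_ideals R"
  shows "ideal_hull R (\<Inter>S) = S"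
  using assms ex_separating_element[OF assms] unfolding ideal_hull_def by blast

text \<open>The hull map is injective because a vertex is the intersection of its hull, and
  surjective because \<open>S\<close> is the hull of \<open>\<Inter>S\<close>.\<close>

lemma comaximal_disjointness_graph:
  assumes "reduced_ring R" "sdim (with_proj (comaximal_ideal_graph R)) \<noteq> \<infinity>"
    and fin: "finite (Max_ideals R)"
  shows "disjointness_graph (comaximal_ideal_graph R) (Max_ideals R) (ideal_hull R)"
proof -
  interpret G: pair_bidirected_digraph "comaximal_ideal_graph R"
    by (rule comaximal_ideal_graph_bidirected)
  have "bij_betw (ideal_hull R) (comaximal_vertices R) (Pow (Max_ideals R) - {{}, Max_ideals R})"
  proof (rule bij_betw_imageI)
    show "inj_on (ideal_hull R) (comaximal_vertices R)"
      using vertex_eq_Inter_hull[OF assms(1,2)] by (metis inj_onI)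
    show "ideal_hull R ` comaximal_vertices R = Pow (Max_ideals R) - {{}, Max_ideals R}"
    proof
      show "ideal_hull R ` comaximal_vertices R \<subseteq> Pow (Max_ideals R) - {{}, Max_ideals R}"
        by (auto simp: comaximal_vertices_iff ideal_hull_def)
      show "Pow (Max_ideals R) - {{}, Max_ideals R} \<subseteq> ideal_hull R ` comaximal_vertices R"
      proof
        fix S assume S: "S \<in> Pow (Max_ideals R) - {{}, Max_ideals R}"
        then have "ideal (\<Inter>S) R" using Max_idealsD(2) by (intro i_Intersect) auto
        moreover have hull: "ideal_hull R (\<Inter>S) = S"
          using S fin finite_subset by (intro ideal_hull_Inter) auto
        ultimately have "\<Inter>S \<in> comaximal_vertices R"
          using S by (simp add: comaximal_vertices_iff)
        with hull show "S \<in> ideal_hull R ` comaximal_vertices R" by (metis imageI)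
      qed
    qed
  qed
  then show ?thesis
    using fin comaximal_arcs_eq by unfold_locales (simp_all add: pverts_comaximal)
qed

end

theorem theorem2p9:
  fixes R :: "('a, 'r) ring_scheme"
  assumes "cring R"
    and "reduced_ring R"
    and "sdim (with_proj (comaximal_ideal_graph R)) \<noteq> \<infinity>"
  shows "(card (Max_ideals R) = 2 \<longrightarrow> sdim (with_proj (comaximal_ideal_graph R)) = 1) \<and>
         (\<forall>n::nat. card (Max_ideals R) = n \<and> n \<ge> 3 \<longrightarrow>
            sdim (with_proj (comaximal_ideal_graph R)) = enat (2 ^ n - 2 * n))"
proof -
  \<comment> \<open>An infinite set has \<open>card\<close> 0, so the bound also makes
    \<open>Max_ideals R\<close> finite.\<close>
  have graph: "disjointness_graph (comaximal_ideal_graph R) (Max_ideals R) (ideal_hull R)"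
    if "2 \<le> card (Max_ideals R)"
    using cring.comaximal_disjointness_graph[OF assms] that card.infinite by fastforce
  then show ?thesis
    using disjointness_graph.sdim_eq_1 disjointness_graph.sdim_eq by fastforce
qed

end
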